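(* Consider the linear system $x_t = Ax_{t-1}+Bu_t$ with initial condition $x_0$, and a sequence of cost functions $L_t(x,u)=f_t^x(x)+f_t^u(u)$, such that Assumptions (i), (ii), (iii) of the context hold. Let $\alpha_u > \frac{2-\sqrt 2}{2+\sqrt 2}\, l_u$, and let the positive step sizes $\gamma_v,\gamma_x$ satisfy $$\frac{2-\sqrt 2}{2\alpha_u} < \gamma_v \le \frac{2}{l_u+\alpha_u}, \qquad \frac{2\|A\|-1}{2\|A\|\alpha_x} < \gamma_x \le \frac{2}{l_x+\alpha_x}.$$ Let $u_t,x_t$ be generated by Algorithm 1 (described in the context) in closed loop with the system. Suppose that for some finite time $t'$ the minimizers of the cost functions satisfy $\theta_t=\theta_{t'}$ and $\eta_t=\eta_{t'}$ for all $t\ge t'$. Then there is a constant $\Lambda\in\mathbb{R}$ independent of $T$ such that for all $T\geq 1$ $$\mathcal{R}(T)\le\sum_{t=1}^T\big(f_t^x(x_t)-f_t^x(\theta_t)+f_t^u(u_t)-f_t^u(\eta_t)\big)<\Lambda,$$ and $\lim_{t\to\infty}x_t=\theta_{t'}$ and $\lim_{t\to\infty}u_t=\eta_{t'}$, i.e., the closed loop converges to the optimal equilibrium.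
   Context: $\|\cdot\|$ is the Euclidean norm for vectors and the induced (spectral) norm for matrices. The system is $x_t = Ax_{t-1}+Bu_t$, $t\ge 1$, with $A\in\mathbb{R}^{n\times n}$, $B\in\mathbb{R}^{n\times m}$, given $x_0\in\mathbb{R}^n$. At each time $t\ge 1$ an input $u_t\in\mathbb{R}^m$ is chosen and applied, then the cost function $L_t:\mathbb{R}^n\times\mathbb{R}^m\to\mathbb{R}$ is revealed. Assumptions. (i) For every $t\ge 0$: $L_t(x,u)=f_t^x(x)+f_t^u(u)$, where $f_t^x:\mathbb{R}^n\to\mathbb{R}$ is (differentiable,) $\alpha_x$-strongly convex and $l_x$-smooth, and $f_t^u:\mathbb{R}^m\to\mathbb{R}$ is $\alpha_u$-strongly convex and $l_u$-smooth, with constants independent of $t$. Here $f$ is $\alpha$-strongly convex ($\alpha>0$) if $f(y)\ge f(x)+\langle\nabla f(x),y-x\rangle+\frac{\alpha}{2}\|y-x\|^2$ for all $x,y$, and $l$-smooth if $f(y)\le f(x)+\langle\nabla f(x),y-x\rangle+\frac{l}{2}\|y-x\|^2$ for all $x,y$. Put $\theta_t=\arg\min_x f_t^x(x)$, $\eta_t=\arg\min_u f_t^u(u)$. (ii) For all $t\ge 1$: $\theta_t=A\theta_t+B\eta_t$. (iii) $(A,B)$ is controllable with controllability index $\mu$, i.e. $\operatorname{rank} S_c=n$ with $S_c=(B\ \ AB\ \cdots\ A^{\mu-1}B)\in\mathbb{R}^{n\times \mu m}$; moreover $\|A\|<\frac{l_x+\alpha_x}{2(l_x-\alpha_x)}$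 (the right-hand side is read as $+\infty$ if $l_x=\alpha_x$). For $A=0$ the lower bound $\frac{2\|A\|-1}{2\|A\|\alpha_x}$ on $\gamma_x$ is read as $-\infty$. Algorithm 1. Let $W=\begin{pmatrix}0_{m\times(\mu-1)m}&0_{m\times m}\\ I_{(\mu-1)m}&0_{(\mu-1)m\times m}\end{pmatrix}\in\mathbb{R}^{\mu m\times\mu m}$ and $e=\begin{pmatrix}0_{m\times(\mu-1)m}&I_m\end{pmatrix}\in\mathbb{R}^{m\times\mu m}$. Given step sizes $\gamma_v,\gamma_x$ and initialization $v_0\in\mathbb{R}^m$, $x_0$, and with $g_t=0$ for $t<1$, at each time $t\ge 1$ (given $x_{t-1}$ and $L_{t-1}$) compute $$v_t=v_{t-1}-\gamma_v\nabla f_{t-1}^u(v_{t-1}),\qquad \hat V_t=(v_t^T,\dots,v_t^T)^T\in\mathbb{R}^{\mu m},$$ $$\hat x_{t+\mu-1}=A^\mu x_{t-1}+S_c\hat V_t+S_c\sum_{i=1}^{\mu-1}W^i g_{t-i},$$ $$g_t=-\gamma_x S_c^T(S_cS_c^T)^{-1}\nabla f_{t-1}^x(\hat x_{t+\mu-1}),\qquad u_t=v_t+\sum_{i=0}^{\mu-1}eW^i g_{t-i},$$ and apply $u_t$ to the system, giving $x_t=Ax_{t-1}+Bu_t$. The fictitious cost $L_0=f_0^x+f_0^u$ is fixed so that it satisfies (i) and its minimizers are $\eta_0=v_0$ and $\theta_0=\hat x_\mu$ (hence $v_1=v_0$, $g_1=0$, and $\theta_0=\hat x_\mu=A^\mu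 x_0+S_c(v_0^T,\dots,v_0^T)^T$). Regret: $\mathcal{R}=\mathcal{R}(T)=\sum_{t=1}^T\big(L_t(x_t,u_t)-L_t(x_t^*,u_t^* )\big)$, where $(x_1^*,\dots,x_T^* )$, $(u_1^*,\dots,u_T^* )$ solve $\min\sum_{t=1}^T L_t(x_t,u_t)$ over $u_1,x_1,\dots,u_T,x_T$ subject to $x_t=Ax_{t-1}+Bu_t$, $t=1,\dots,T$, with the given $x_0$. *)

theory Defs
  imports "HOL-Analysis.Analysis"
begin

definition grad :: "('a::euclidean_space \<Rightarrow> real) \<Rightarrow> 'a \<Rightarrow> 'a" where
  "grad f x = (THE D. GDERIV f x :> D)"

definition strongly_convex :: "real \<Rightarrow> ('a::euclidean_space \<Rightarrow> real) \<Rightarrow> bool" where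
  "strongly_convex \<alpha> f \<longleftrightarrow> \<alpha> > 0 \<and> (\<forall>x. f differentiable (at x)) \<and>
     (\<forall>x y. f y \<ge> f x + grad f x \<bullet> (y - x) + \<alpha> / 2 * (norm (y - x))\<^sup>2)"

definition smooth :: "real \<Rightarrow> ('a::euclidean_space \<Rightarrow> real) \<Rightarrow> bool" where
  "smooth l f \<longleftrightarrow> (\<forall>x. f differentiable (at x)) \<and>
     (\<forall>x y. f y \<le> f x + grad f x \<bullet> (y - x) + l / 2 * (norm (y - x))\<^sup>2)"

definition spectral_norm :: "real^'n^'m \<Rightarrow> real" where
  "spectral_norm A = onorm ((*v) A)"

primrec mpow :: "real^'n^'n \<Rightarrow> nat \<Rightarrow> real^'n^'n" where
  "mpow A 0 = mat 1"
| "mpow A (Suc k) = A ** mpow A k"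

text \<open>
  Vectors in \<open>\<real>\<^bsup>\<mu>m\<^esup>\<close> are modelled as \<open>real^('k \<times> 'm)\<close> with
  \<open>\<mu> = CARD('k)\<close>: the index \<open>(k, j)\<close> is entry \<open>j\<close> of block number \<open>block k\<close>,
  where the blocks are numbered \<open>0, \<dots>, \<mu> - 1\<close> along the linear order of \<open>'k\<close>.
\<close>

definition block :: "'k::{finite,linorder} \<Rightarrow> nat" where
  "block k = card {i. i < k}"

lemma bij_betw_block: "bij_betw block (UNIV :: 'k::{finite,linorder} set) {..<CARD('k)}"
proof -
  have less: "block a < block b" if "a < b" for a b :: 'k
    unfolding block_def using that by (intro psubset_card_mono) auto
  have inj: "inj (block :: 'k \<Rightarrow> nat)"
  proof (rule injI)
    fix a b :: 'k assume "block a = block b"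
    then show "a = b" using less[of a b] less[of b a] by (cases a b rule: linorder_cases) auto
  qed
  have "block (k :: 'k) < CARD('k)" for k
    unfolding block_def by (intro psubset_card_mono) auto
  then have "block ` (UNIV :: 'k set) \<subseteq> {..<CARD('k)}" by auto
  then have "block ` (UNIV :: 'k set) = {..<CARD('k)}"
    by (intro card_subset_eq) (auto simp: card_image inj)
  with inj show ?thesis by (simp add: bij_betw_def)
qed

text \<open>\<open>S\<^sub>c = (B  AB  \<dots>  A\<^bsup>\<mu>-1\<^esup>B)\<close>\<close>
definition ctrb :: "real^'n^'n \<Rightarrow> real^'m^'n \<Rightarrow> real^('k::{finite,linorder} \<times> 'm::finite)^'n" where
  "ctrb A B = (\<chi> i p. (mpow A (block (fst p)) ** B) $ i $ snd p)"

text \<open>The block down-shift \<open>W\<close> and the selector \<open>e\<close> of the last block.\<close>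
definition W_mat :: "real^('k::{finite,linorder} \<times> 'm::finite)^('k \<times> 'm)" where
  "W_mat = (\<chi> p q. if block (fst p) = block (fst q) + 1 \<and> snd p = snd q then 1 else 0)"

definition e_mat :: "real^('k::{finite,linorder} \<times> 'm::finite)^'m" where
  "e_mat = (\<chi> j q. if block (fst q) + 1 = CARD('k) \<and> snd q = j then 1 else 0)"

text \<open>\<open>(v\<^sup>T, \<dots>, v\<^sup>T)\<^sup>T\<close>\<close>
definition stack :: "real^'m \<Rightarrow> real^('k::{finite,linorder} \<times> 'm::finite)" where
  "stack v = (\<chi> p. v $ snd p)"

definition linear_system ::
  "real^'n^'n \<Rightarrow> real^'m^'n \<Rightarrow> (nat \<Rightarrow> real^'n) \<Rightarrow> (nat \<Rightarrow> real^'m) \<Rightarrow> bool" where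
  "linear_system A B x u \<longleftrightarrow> (\<forall>t\<ge>1. x t = A *v x (t - 1) + B *v u t)"

text \<open>
  The convention \<open>g\<^sub>t = 0\<close> for \<open>t < 1\<close> is captured by \<open>g 0 = 0\<close>, because
  \<open>t - i\<close> is truncated subtraction on \<open>nat\<close>. The parameter \<open>S\<close> stands for \<open>S\<^sub>c\<close>.
\<close>
definition algorithm1 ::
  "real^'n^'n \<Rightarrow> real^('k::{finite,linorder} \<times> 'm::finite)^'n \<Rightarrow> real \<Rightarrow> real \<Rightarrow>
   (nat \<Rightarrow> real^'n \<Rightarrow> real) \<Rightarrow> (nat \<Rightarrow> real^'m \<Rightarrow> real) \<Rightarrow>
   (nat \<Rightarrow> real^'n) \<Rightarrow> (nat \<Rightarrow> real^'m) \<Rightarrow> (nat \<Rightarrow> real^'n) \<Rightarrow>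
   (nat \<Rightarrow> real^('k \<times> 'm)) \<Rightarrow> (nat \<Rightarrow> real^'m) \<Rightarrow> bool" where
  "algorithm1 A S \<gamma>v \<gamma>x fx fu x v xhat g u \<longleftrightarrow>
     (let \<mu> = CARD('k) in
      g 0 = 0 \<and>
      (\<forall>t\<ge>1.
         v t = v (t - 1) - \<gamma>v *\<^sub>R grad (fu (t - 1)) (v (t - 1)) \<and>
         xhat (t + \<mu> - 1) = mpow A \<mu> *v x (t - 1) + S *v stack (v t)
           + S *v (\<Sum>i=1..\<mu> - 1. mpow W_mat i *v g (t - i)) \<and>
         g t = - (\<gamma>x *\<^sub>R ((transpose S ** matrix_inv (S ** transpose S))
                          *v grad (fx (t - 1)) (xhat (t + \<mu> - 1)))) \<and>
         u t = v t + (\<Sum>i=0..\<mu> - 1. (e_mat ** mpow W_mat i) *v g (t - i))))"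

definition total_cost ::
  "(nat \<Rightarrow> real^'n \<Rightarrow> real^'m \<Rightarrow> real) \<Rightarrow> nat \<Rightarrow>
   (nat \<Rightarrow> real^'n) \<times> (nat \<Rightarrow> real^'m) \<Rightarrow> real" where
  "total_cost L T = (\<lambda>(x, u). \<Sum>t=1..T. L t (x t) (u t))"

definition feasible ::
  "real^'n^'n \<Rightarrow> real^'m^'n \<Rightarrow> real^'n \<Rightarrow> nat \<Rightarrow>
   (nat \<Rightarrow> real^'n) \<times> (nat \<Rightarrow> real^'m) \<Rightarrow> bool" where
  "feasible A B x0 T = (\<lambda>(x, u). x 0 = x0 \<and> (\<forall>t\<in>{1..T}. x t = A *v x (t - 1) + B *v u t))"

text \<open>
  Only the entries \<open>1, \<dots>, T\<close> of the optimal sequences matter; for strongly convex stage costs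
  these are uniquely determined, so the choice made by \<open>arg_min\<close> is immaterial.
\<close>
definition regret ::
  "(nat \<Rightarrow> real^'n \<Rightarrow> real^'m \<Rightarrow> real) \<Rightarrow> real^'n^'n \<Rightarrow> real^'m^'n \<Rightarrow> real^'n \<Rightarrow>
   (nat \<Rightarrow> real^'n) \<Rightarrow> (nat \<Rightarrow> real^'m) \<Rightarrow> nat \<Rightarrow> real" where
  "regret L A B x0 x u T =
     (let (xs, us) = arg_min (total_cost L T) (feasible A B x0 T)
      in \<Sum>t=1..T. (L t (x t) (u t) - L t (xs t) (us t)))"

end

theory Submission
  imports Defs
begin

text \<open>
  Write \<open>X t\<close> for \<open>xhat (t + \<mu>)\<close>, the state predicted \<open>\<mu>\<close> steps after \<open>x t\<close> if the input part
  \<open>v (Suc t)\<close> is kept and no further correction \<open>g\<close> is made. The convergence proof rests on the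
  fact that this prediction obeys a recursion of its own. Since \<open>g (Suc t)\<close> is chosen through a right
  inverse of \<open>S\<close>, the predicted state after the correction is a plain gradient step,
  \<open>y t = X t + S *v g (Suc t) = X t - \<gamma>x *\<^sub>R grad (fx t) (X t)\<close>, and the shift structure of \<open>S\<close>
  (\<open>mat_mult_ctrb\<close>, \<open>mat_mult_ctrb_stack\<close>) yields
  \<open>X (Suc t) = A *v y t + B *v v (Suc t) + S *v (stack (v (Suc (Suc t))) - stack (v (Suc t)))\<close>.

  A gradient step with step size at most \<open>2 / (l + \<alpha>)\<close> contracts the distance to the minimizer by
  \<open>1 - \<gamma> * \<alpha>\<close> (\<open>grad_step_contracts\<close>). Hence \<open>v t - \<eta> t\<close> contracts up to the increments of \<open>\<eta>\<close>.
  Because \<open>\<theta> t\<close> is an equilibrium for \<open>\<eta> t\<close>, \<open>X t - \<theta> t\<close> contracts with factor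
  \<open>spectral_norm A * (1 - \<gamma>x * \<alpha>x)\<close>, which the lower bound on \<open>\<gamma>x\<close> makes smaller than \<open>1/2\<close>, up to
  terms controlled by the increments of \<open>\<theta>\<close> and by \<open>v\<close>.

  The increments vanish eventually, so all perturbations have summable norms, and summability
  passes through perturbed contractions (\<open>norm_summable_contraction\<close>), linear maps, delays and
  finite sums. This covers \<open>g\<close>, then \<open>u t - \<eta> t\<close>. For the state, the formula for \<open>X t\<close> and
  \<open>equilibrium_steers_to_itself\<close> give summability of \<open>mpow A \<mu> *v (x t - \<theta> t)\<close>, and the plant equation
  lowers the power of \<open>A\<close> one at a time down to \<open>0\<close>. Summability implies both limits; as each cost
  gap is at most quadratic in the distance to the minimizer (\<open>cost_gap_le\<close>), it bounds the sum of
  the gaps as well. The regret is below that sum, since any trajectory costs at least the sum of the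
  stagewise minima.
\<close>

section \<open>Gradient steps on strongly convex smooth functions\<close>

text \<open>
  The vector \<open>q x y\<close> is the difference of the gradients of \<open>f - \<alpha>/2 * (norm _)\<^sup>2\<close>, a convex and
  \<open>(l - \<alpha>)\<close>-smooth function, and the first inequality is the cocoercivity of its gradient. Working
  with \<open>q\<close> directly, one compares the lower bound at \<open>x\<close> with the upper bound at \<open>y\<close> in the point
  \<open>y + s\<close>, chooses \<open>s\<close> along \<open>q x y\<close>, and adds the same inequality with \<open>x\<close> and \<open>y\<close> exchanged.
\<close>
lemma shifted_grad_coercive:
  assumes sc: "strongly_convex \<alpha> f" and sm: "smooth l f"
  defines "q \<equiv> \<lambda>x y. grad f x - grad f y - \<alpha> *\<^sub>R (x - y)"
  shows "(norm (q x y))\<^sup>2 \<le> (l - \<alpha>) * (q x y \<bullet> (x - y))" and "0 \<le> q x y \<bullet> (x - y)" and "\<alpha> \<le> l"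
proof -
  have lo: "f z \<ge> f w + grad f w \<bullet> (z - w) + \<alpha> / 2 * (norm (z - w))\<^sup>2" for w z
    using sc by (auto simp: strongly_convex_def)
  have up: "f z \<le> f w + grad f w \<bullet> (z - w) + l / 2 * (norm (z - w))\<^sup>2" for w z
    using sm by (auto simp: smooth_def)
  have half: "q w z \<bullet> s - (l - \<alpha>) / 2 * (norm s)\<^sup>2
      \<le> f z - f w + grad f w \<bullet> (w - z) - \<alpha> / 2 * (norm (w - z))\<^sup>2" for w z s
  proof -
    have 1: "f w + grad f w \<bullet> (z + s - w) + \<alpha> / 2 * (norm (z + s - w))\<^sup>2
        \<le> f z + grad f z \<bullet> s + l / 2 * (norm s)\<^sup>2"
      using lo[of w "z + s"] up[of "z + s" z] by simp
    have 2: "(norm (z + s - w))\<^sup>2 = (norm s)\<^sup>2 - 2 * (s \<bullet> (w - z)) + (norm (w - z))\<^sup>2"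
      unfolding power2_norm_eq_inner by (simp add: inner_simps inner_commute algebra_simps)
    have 3: "q w z \<bullet> s = grad f w \<bullet> s - grad f z \<bullet> s - \<alpha> * (s \<bullet> (w - z))"
      by (simp add: q_def inner_simps inner_commute algebra_simps)
    have 4: "grad f w \<bullet> (z + s - w) = grad f w \<bullet> s - grad f w \<bullet> (w - z)"
      by (simp add: inner_simps)
    show ?thesis using 1 unfolding 2 3 4 by (simp add: algebra_simps add_divide_distrib diff_divide_distrib)
  qed
  have swap: "q y x = - q x y" by (simp add: q_def algebra_simps)
  have key: "2 * c * (norm (q x y))\<^sup>2 - (l - \<alpha>) * c\<^sup>2 * (norm (q x y))\<^sup>2 \<le> q x y \<bullet> (x - y)" for c
  proof -
    define K where "K = (l - \<alpha>) * c\<^sup>2 * (norm (q x y))\<^sup>2"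
    have "q x y \<bullet> (x - y) = grad f x \<bullet> (x - y) + grad f y \<bullet> (y - x) - \<alpha> * (norm (x - y))\<^sup>2"
      unfolding power2_norm_eq_inner by (simp add: q_def inner_simps inner_commute algebra_simps)
    moreover have "c * (norm (q x y))\<^sup>2 - K / 2
        \<le> f y - f x + grad f x \<bullet> (x - y) - \<alpha> / 2 * (norm (x - y))\<^sup>2"
      using half[of x y "c *\<^sub>R q x y"]
      by (simp add: K_def power2_norm_eq_inner[symmetric] power_mult_distrib ac_simps)
    moreover have "c * (norm (q x y))\<^sup>2 - K / 2
        \<le> f x - f y + grad f y \<bullet> (y - x) - \<alpha> / 2 * (norm (x - y))\<^sup>2"
      using half[of y x "c *\<^sub>R q y x"] unfolding swap norm_minus_commute[of y x]
      by (simp add: K_def power2_norm_eq_inner[symmetric] power_mult_distrib ac_simps)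
    ultimately show ?thesis unfolding K_def[symmetric] by linarith
  qed
  show nonneg: "0 \<le> q x y \<bullet> (x - y)" using key[of 0] by simp
  obtain b :: 'a where b: "b \<in> Basis" using nonempty_Basis by blast
  show le: "\<alpha> \<le> l"
    using lo[of 0 b] up[of b 0] b by simp
  show "(norm (q x y))\<^sup>2 \<le> (l - \<alpha>) * (q x y \<bullet> (x - y))"
  proof (cases "l = \<alpha>")
    case True
    \<comment> \<open>Here the left side of \<open>key\<close> is unbounded in \<open>c\<close> unless the shifted gradients agree.\<close>
    have "q x y = 0"
    proof (rule ccontr)
      assume "q x y \<noteq> 0"
      then have "(norm (q x y))\<^sup>2 > 0" by simp
      then show False
        using key[of "(q x y \<bullet> (x - y) + 1) / (2 * (norm (q x y))\<^sup>2)"] True by simp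
    qed
    then show ?thesis using True by simp
  next
    case False
    with le have pos: "l - \<alpha> > 0" by simp
    then have "(l - \<alpha>) * (1 / (l - \<alpha>))\<^sup>2 = 1 / (l - \<alpha>)"
      by (simp add: power2_eq_square)
    then have "(norm (q x y))\<^sup>2 / (l - \<alpha>) \<le> q x y \<bullet> (x - y)"
      using key[of "1 / (l - \<alpha>)"] by simp
    then show ?thesis using pos by (simp add: field_simps)
  qed
qed

text \<open>
  With \<open>d = x - z\<close> the new error is \<open>(1 - \<gamma> * \<alpha>) *\<^sub>R d - \<gamma> *\<^sub>R q\<close>. In its squared norm, coercivity
  absorbs \<open>norm q\<close> into \<open>q \<bullet> d\<close>, whose total coefficient \<open>\<gamma> * (\<gamma> * (l + \<alpha>) - 2)\<close> is nonpositive.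
  The exact factor \<open>1 - \<gamma> * \<alpha>\<close> matters: the norm of \<open>A\<close> may exceed \<open>1\<close>, and this factor has to
  compensate for it.
\<close>
lemma grad_step_contracts:
  assumes sc: "strongly_convex \<alpha> f" and sm: "smooth l f"
    and \<gamma>: "0 < \<gamma>" "\<gamma> \<le> 2 / (l + \<alpha>)" and crit: "grad f z = 0"
  shows "norm (x - \<gamma> *\<^sub>R grad f x - z) \<le> (1 - \<gamma> * \<alpha>) * norm (x - z)"
    and "0 < \<gamma> * \<alpha>" "\<gamma> * \<alpha> \<le> 1"
proof -
  define q where "q = grad f x - grad f z - \<alpha> *\<^sub>R (x - z)"
  define d where "d = x - z"
  have q: "(norm q)\<^sup>2 \<le> (l - \<alpha>) * (q \<bullet> d)" "0 \<le> q \<bullet> d" and le: "\<alpha> \<le> l"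
    using shifted_grad_coercive[OF sc sm] unfolding q_def d_def by auto
  have \<alpha>: "\<alpha> > 0" using sc by (simp add: strongly_convex_def)
  then show "0 < \<gamma> * \<alpha>" using \<gamma> by simp
  have sum: "\<gamma> * (l + \<alpha>) \<le> 2" using \<gamma> \<alpha> le by (simp add: field_simps)
  have "\<gamma> * \<alpha> \<le> \<gamma> * l" using le \<gamma> by simp
  then show le1: "\<gamma> * \<alpha> \<le> 1" using sum by (simp add: algebra_simps)
  have "x - \<gamma> *\<^sub>R grad f x - z = (1 - \<gamma> * \<alpha>) *\<^sub>R d - \<gamma> *\<^sub>R q"
    using crit by (simp add: q_def d_def algebra_simps)
  moreover have "(norm (r *\<^sub>R d - \<gamma> *\<^sub>R q))\<^sup>2
      = r\<^sup>2 * (norm d)\<^sup>2 - 2 * \<gamma> * r * (q \<bullet> d) + \<gamma>\<^sup>2 * (norm q)\<^sup>2" for r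
    unfolding power2_norm_eq_inner
    by (simp add: inner_simps inner_commute power2_eq_square algebra_simps)
  ultimately have "(norm (x - \<gamma> *\<^sub>R grad f x - z))\<^sup>2
      = (1 - \<gamma> * \<alpha>)\<^sup>2 * (norm d)\<^sup>2 - 2 * \<gamma> * (1 - \<gamma> * \<alpha>) * (q \<bullet> d) + \<gamma>\<^sup>2 * (norm q)\<^sup>2"
    by simp
  also have "\<dots> \<le> (1 - \<gamma> * \<alpha>)\<^sup>2 * (norm d)\<^sup>2 - 2 * \<gamma> * (1 - \<gamma> * \<alpha>) * (q \<bullet> d)
      + \<gamma>\<^sup>2 * ((l - \<alpha>) * (q \<bullet> d))"
    using q by (intro add_left_mono mult_left_mono) auto
  also have "\<dots> = (1 - \<gamma> * \<alpha>)\<^sup>2 * (norm d)\<^sup>2 - \<gamma> * (2 - \<gamma> * (l + \<alpha>)) * (q \<bullet> d)"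
    by (simp add: power2_eq_square algebra_simps)
  also have "\<dots> \<le> (1 - \<gamma> * \<alpha>)\<^sup>2 * (norm d)\<^sup>2"
    using sum q \<gamma> by simp
  finally have "(norm (x - \<gamma> *\<^sub>R grad f x - z))\<^sup>2 \<le> ((1 - \<gamma> * \<alpha>) * norm d)\<^sup>2"
    by (simp add: power_mult_distrib)
  then show "norm (x - \<gamma> *\<^sub>R grad f x - z) \<le> (1 - \<gamma> * \<alpha>) * norm (x - z)"
    unfolding d_def by (rule power2_le_imp_le) (use le1 in simp)
qed

text \<open>
  Outside the ball of radius \<open>2 * norm (grad f 0) / \<alpha>\<close> the quadratic lower bound at \<open>0\<close> already
  exceeds \<open>f 0\<close>, so a minimum over this ball is global.
\<close>
lemma strongly_convex_attains_min:
  assumes sc: "strongly_convex \<alpha> f"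
  shows "f (ARG_MIN f y. True) \<le> f z"
proof -
  have \<alpha>: "\<alpha> > 0" and lo: "f y \<ge> f w + grad f w \<bullet> (y - w) + \<alpha> / 2 * (norm (y - w))\<^sup>2" for w y
    using sc by (auto simp: strongly_convex_def)
  have cont: "continuous_on S f" for S
    using sc by (auto simp: strongly_convex_def intro!: continuous_at_imp_continuous_on
        differentiable_imp_continuous_within)
  define R where "R = 2 * norm (grad f 0) / \<alpha>"
  have R: "R \<ge> 0" using \<alpha> by (simp add: R_def)
  obtain m where m: "\<And>y. y \<in> cball 0 R \<Longrightarrow> f m \<le> f y"
    using continuous_attains_inf[of "cball 0 R" f] cont R by (metis cball_eq_empty compact_cball not_less)
  have "f m \<le> f y" for y
  proof (cases "norm y \<le> R")
    case True
    then show ?thesis using m by simp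
  next
    case False
    have "- (norm (grad f 0) * norm y) \<le> grad f 0 \<bullet> y"
      using Cauchy_Schwarz_ineq2[of "grad f 0" y] by linarith
    moreover have "norm (grad f 0) * norm y \<le> \<alpha> / 2 * norm y * norm y"
      using False \<alpha> by (intro mult_right_mono) (auto simp: R_def field_simps)
    ultimately have "f 0 \<le> f y"
      using lo[of 0 y] by (simp add: power2_eq_square)
    then show ?thesis using m[of 0] R by simp
  qed
  then have "\<exists>m. is_arg_min f (\<lambda>_. True) m"
    by (auto simp: is_arg_min_def not_less)
  then have "is_arg_min f (\<lambda>_. True) (ARG_MIN f y. True)"
    unfolding arg_min_def by (rule someI_ex)
  then show ?thesis by (auto simp: is_arg_min_def not_less)
qed

text \<open>A step of size \<open>1 / l\<close> along the negative gradient would otherwise decrease \<open>f\<close> further.\<close>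
lemma grad_arg_min_eq_0:
  assumes sc: "strongly_convex \<alpha> f" and sm: "smooth l f"
  shows "grad f (ARG_MIN f y. True) = 0"
proof -
  define z where "z = (ARG_MIN f y. True)"
  have l: "l > 0" using sc shifted_grad_coercive(3)[OF sc sm] by (auto simp: strongly_convex_def)
  have "f z \<le> f (z - (1 / l) *\<^sub>R grad f z)"
    unfolding z_def by (rule strongly_convex_attains_min[OF sc])
  also have "\<dots> \<le> f z + grad f z \<bullet> (- ((1 / l) *\<^sub>R grad f z)) + l / 2 * (norm ((1 / l) *\<^sub>R grad f z))\<^sup>2"
    using sm[unfolded smooth_def, THEN conjunct2, rule_format, of "z - (1 / l) *\<^sub>R grad f z" z] by simp
  also have "\<dots> = f z - (norm (grad f z))\<^sup>2 / (2 * l)"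
    unfolding power2_norm_eq_inner using l by (simp add: field_simps)
  finally have "(norm (grad f z))\<^sup>2 \<le> 0" using l by (simp add: field_simps)
  then show ?thesis by (simp add: z_def)
qed

lemma cost_gap_le:
  assumes sc: "strongly_convex \<alpha> f" and sm: "smooth l f"
  shows "f x - f (ARG_MIN f y. True) \<le> l / 2 * (norm (x - (ARG_MIN f y. True)))\<^sup>2"
  using sm[unfolded smooth_def, THEN conjunct2, rule_format, of x "ARG_MIN f y. True"]
    grad_arg_min_eq_0[OF sc sm] by simp

section \<open>Sequences with summable norms\<close>

text \<open>
  One closure calculus serves both conclusions, convergence and bounded accumulated cost. Unlike
  exponential decay it needs no bookkeeping of rates, and finitely many initial terms never matter.
\<close>
definition norm_summable :: "(nat \<Rightarrow> 'a::real_normed_vector) \<Rightarrow> bool" where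
  "norm_summable z \<longleftrightarrow> summable (\<lambda>t. norm (z t))"

lemma norm_summable_bound:
  assumes "norm_summable z" and "\<And>t. t \<ge> N \<Longrightarrow> norm (w t) \<le> norm (z t)"
  shows "norm_summable w"
  using assms(1) unfolding norm_summable_def
  by (rule summable_comparison_test'[of _ N]) (simp add: assms(2))

lemma norm_summable_eventually_0: "(\<And>t. t \<ge> N \<Longrightarrow> z t = 0) \<Longrightarrow> norm_summable z"
  by (rule norm_summable_bound[of "\<lambda>_. 0::real" N]) (auto simp: norm_summable_def)

lemma norm_summable_add:
  assumes "norm_summable z" "norm_summable w"
  shows "norm_summable (\<lambda>t. z t + w t)"
proof -
  have "summable (\<lambda>t. norm (z t) + norm (w t))"
    using assms unfolding norm_summable_def by (rule summable_add)
  then show ?thesis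
    unfolding norm_summable_def by (rule summable_comparison_test'[of _ 0]) (simp add: norm_triangle_ineq)
qed

lemma norm_summable_linear:
  assumes z: "norm_summable z" and h: "bounded_linear h"
  shows "norm_summable (\<lambda>t. h (z t))"
proof -
  obtain K where K: "\<And>w. norm (h w) \<le> norm w * K" using bounded_linear.bounded[OF h] by blast
  have "summable (\<lambda>t. norm (z t) * K)"
    using z unfolding norm_summable_def by (rule summable_mult2)
  then show ?thesis
    unfolding norm_summable_def by (rule summable_comparison_test'[of _ 0]) (simp add: K)
qed

lemma norm_summable_mat: "norm_summable z \<Longrightarrow> norm_summable (\<lambda>t. M *v z t)"
  for M :: "real^'a^'b"
  by (rule norm_summable_linear) auto

lemma norm_summable_uminus: "norm_summable z \<Longrightarrow> norm_summable (\<lambda>t. - z t)"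
  by (simp add: norm_summable_def)

lemma norm_summable_diff:
  "norm_summable z \<Longrightarrow> norm_summable w \<Longrightarrow> norm_summable (\<lambda>t. z t - w t)"
  using norm_summable_add[of z "\<lambda>t. - w t"] norm_summable_uminus[of w] by simp

lemma norm_summable_sum:
  assumes "\<And>i. i \<in> I \<Longrightarrow> norm_summable (z i)"
  shows "norm_summable (\<lambda>t. \<Sum>i\<in>I. z i t)"
  using assms
  by (induction I rule: infinite_finite_induct)
    (auto intro: norm_summable_add norm_summable_eventually_0)

lemma norm_summable_Suc: "norm_summable (\<lambda>t. z (Suc t)) \<longleftrightarrow> norm_summable z"
  unfolding norm_summable_def by (rule summable_Suc_iff)

lemma norm_summable_delay: "norm_summable z \<Longrightarrow> norm_summable (\<lambda>t. z (t - i))"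
  unfolding norm_summable_def using summable_iff_shift[of "\<lambda>t. norm (z (t - i))" i] by simp

lemma norm_summable_cong:
  "norm_summable z \<Longrightarrow> (\<And>t. t \<ge> N \<Longrightarrow> w t = z t) \<Longrightarrow> norm_summable w"
  by (erule norm_summable_bound[of _ N]) simp

lemma norm_summable_tendsto_0: "norm_summable z \<Longrightarrow> z \<longlonglongrightarrow> 0"
  unfolding norm_summable_def by (drule summable_LIMSEQ_zero) (rule tendsto_norm_zero_cancel)

lemma norm_summable_square:
  assumes "norm_summable z"
  shows "summable (\<lambda>t. (norm (z t))\<^sup>2)"
proof -
  have "eventually (\<lambda>t. norm (z t) < 1) sequentially"
    using tendsto_norm_zero[OF norm_summable_tendsto_0[OF assms]]
    by (rule order_tendstoD) simp
  then obtain N where "\<And>t. t \<ge> N \<Longrightarrow> norm (z t) < 1"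
    by (auto simp: eventually_sequentially)
  then have "norm ((norm (z t))\<^sup>2) \<le> norm (z t)" if "t \<ge> N" for t
    using that by (simp add: power2_eq_square mult_left_le less_imp_le)
  then show ?thesis
    using assms unfolding norm_summable_def by (rule summable_comparison_test'[rotated])
qed

text \<open>
  Summing the inequality over \<open>t\<close> bounds \<open>1 - r\<close> times the partial sums by the initial term plus the
  total perturbation.
\<close>
lemma norm_summable_contraction:
  assumes r: "0 \<le> r" "r < 1" and w: "norm_summable w"
    and step: "\<And>t. t \<ge> N \<Longrightarrow> norm (z (Suc t)) \<le> r * norm (z t) + norm (w t)"
  shows "norm_summable z"
proof -
  define a b where "a = (\<lambda>t. norm (z (t + N)))" and "b = (\<lambda>t. norm (w (t + N)))"
  have b: "summable b" and b0: "\<And>t. b t \<ge> 0"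
    using w summable_iff_shift[of "\<lambda>t. norm (w t)" N] by (auto simp: b_def norm_summable_def)
  have ab: "a (Suc t) \<le> r * a t + b t" for t
    using step[of "t + N"] by (simp add: a_def b_def)
  have sum: "(1 - r) * (\<Sum>t<n. a t) + a n \<le> a 0 + (\<Sum>t<n. b t)" for n
  proof (induction n)
    case (Suc n)
    then show ?case using ab[of n] by (simp add: algebra_simps)
  qed simp
  have "(\<Sum>t<n. a t) \<le> (a 0 + suminf b) / (1 - r)" for n
  proof -
    have "(\<Sum>t<n. b t) \<le> suminf b" using b b0 by (intro sum_le_suminf) auto
    moreover have "a n \<ge> 0" by (simp add: a_def)
    ultimately have "(1 - r) * (\<Sum>t<n. a t) \<le> a 0 + suminf b" using sum[of n] by linarith
    then show ?thesis using r by (simp add: field_simps)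
  qed
  then have "summable a" by (intro summableI_nonneg_bounded) (auto simp: a_def)
  then show ?thesis
    using summable_iff_shift[of "\<lambda>t. norm (z t)" N] by (simp add: a_def norm_summable_def)
qed

section \<open>Block structure of the controllability matrix\<close>

lemma matrix_vector_mult_sum_right: "M *v (\<Sum>i\<in>I. z i) = (\<Sum>i\<in>I. M *v z i)"
  for M :: "real^'a^'b"
  by (rule linear_sum) simp

lemma matrix_vector_mult_minus_right: "M *v (- z) = - (M *v z)"
  for M :: "real^'a^'b"
  by (rule linear_neg) simp

lemma mpow_commute: "mpow A k ** A = A ** mpow A k"
  by (induction k) (simp_all add: matrix_mul_assoc[symmetric])

definition unblock :: "nat \<Rightarrow> 'k::{finite,linorder}" where
  "unblock = inv block"

lemma block_unblock: "j < CARD('k) \<Longrightarrow> block (unblock j :: 'k::{finite,linorder}) = j"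
  unfolding unblock_def using bij_betw_block[where 'k='k]
  by (intro f_inv_into_f) (auto simp: bij_betw_def)

lemma unblock_block: "unblock (block k) = (k :: 'k::{finite,linorder})"
  unfolding unblock_def using bij_betw_block[where 'k='k]
  by (intro inv_f_f) (auto simp: bij_betw_def)

lemma block_less: "block (k::'k::{finite,linorder}) < CARD('k)"
  using bij_betw_block[where 'k='k] by (auto simp: bij_betw_def)

text \<open>
  Blocks are addressed by their number rather than by their index in \<open>'k\<close>, so that sums over
  blocks become sums over \<open>{..<CARD('k)}\<close> and can be shifted.
\<close>
definition piece :: "nat \<Rightarrow> real^('k::{finite,linorder} \<times> 'm::finite) \<Rightarrow> real^'m" where
  "piece j w = (\<chi> i. w $ (unblock j, i))"

lemma piece_stack: "piece j (stack v) = v"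
  by (simp add: piece_def stack_def vec_eq_iff)

lemma sum_over_blocks:
  "(\<Sum>p\<in>UNIV. h p) = (\<Sum>j<CARD('k). \<Sum>i\<in>UNIV. h (unblock j, i))"
  for h :: "'k::{finite,linorder} \<times> 'm::finite \<Rightarrow> real"
proof -
  have "(\<Sum>p\<in>UNIV. h p) = (\<Sum>k\<in>UNIV. \<Sum>i\<in>UNIV. h (k :: 'k, i))"
    by (simp add: sum.cartesian_product UNIV_Times_UNIV[symmetric] del: UNIV_Times_UNIV)
  also have "\<dots> = (\<Sum>k\<in>UNIV. \<Sum>i\<in>UNIV. h (unblock (block (k :: 'k)), i))"
    by (simp add: unblock_block)
  also have "\<dots> = (\<Sum>j<CARD('k). \<Sum>i\<in>UNIV. h (unblock j, i))"
    by (rule sum.reindex_bij_betw[OF bij_betw_block])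
  finally show ?thesis .
qed

lemma ctrb_mult_vec:
  "(ctrb A B :: real^('k::{finite,linorder} \<times> 'm::finite)^'n) *v w
    = (\<Sum>j<CARD('k). mpow A j *v (B *v piece j w))"
proof -
  have "(ctrb A B *v w) $ i = (\<Sum>j<CARD('k). mpow A j *v (B *v piece j w)) $ i" for i
  proof -
    have "(ctrb A B *v w) $ i = (\<Sum>p\<in>UNIV. (mpow A (block (fst p)) ** B) $ i $ snd p * w $ p)"
      by (simp add: ctrb_def matrix_vector_mult_def)
    also have "\<dots> = (\<Sum>j<CARD('k). \<Sum>l\<in>UNIV. (mpow A j ** B) $ i $ l * w $ (unblock j, l))"
      unfolding sum_over_blocks by (intro sum.cong) (auto simp: block_unblock)
    also have "\<dots> = (\<Sum>j<CARD('k). ((mpow A j ** B) *v piece j w) $ i)"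
      by (simp add: piece_def matrix_vector_mult_def)
    finally show ?thesis by (simp add: matrix_vector_mul_assoc)
  qed
  then show ?thesis by (simp add: vec_eq_iff)
qed

lemma e_mat_mult_vec: "e_mat *v w = piece (CARD('k) - 1) w"
  for w :: "real^('k::{finite,linorder} \<times> 'm::finite)"
proof -
  have "(e_mat *v w) $ i = piece (CARD('k) - 1) w $ i" for i
  proof -
    have eq: "block k + 1 = CARD('k) \<longleftrightarrow> k = unblock (CARD('k) - 1)" for k :: 'k
    proof
      assume "block k + 1 = CARD('k)"
      then show "k = unblock (CARD('k) - 1)" by (metis add_diff_cancel_right' unblock_block)
    next
      assume "k = unblock (CARD('k) - 1)"
      then show "block k + 1 = CARD('k)" by (simp add: block_unblock)
    qed
    have "(e_mat *v w) $ i = (\<Sum>p\<in>UNIV. if p = (unblock (CARD('k) - 1), i) then w $ p else 0)"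
      unfolding matrix_vector_mult_def e_mat_def eq
      by (simp add: prod_eq_iff if_distrib[of "\<lambda>a. a * _"] cong: if_cong)
    then show ?thesis by (simp add: piece_def)
  qed
  then show ?thesis by (simp add: vec_eq_iff)
qed

lemma piece_W_mat:
  fixes w :: "real^('k::{finite,linorder} \<times> 'm::finite)"
  assumes j: "j < CARD('k)"
  shows "piece j (W_mat *v w) = (if j = 0 then 0 else piece (j - 1) w)"
proof -
  have "piece j (W_mat *v w) $ i = (if j = 0 then 0 else piece (j - 1) w) $ i" for i
  proof -
    have "piece j (W_mat *v w) $ i
        = (\<Sum>p\<in>UNIV. if j = block (fst p) + 1 \<and> i = snd p then w $ p else 0)"
      using j by (auto simp: piece_def matrix_vector_mult_def W_mat_def block_unblock intro!: sum.cong)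
    also have "\<dots> = (\<Sum>p\<in>UNIV. if p = (unblock (j - 1), i) then (if j = 0 then 0 else w $ p) else 0)"
    proof (intro sum.cong refl)
      fix p :: "'k \<times> 'm"
      have "j \<noteq> 0 \<Longrightarrow> j = block (fst p) + 1 \<longleftrightarrow> fst p = unblock (j - 1)"
        using j by (metis Suc_eq_plus1 Suc_pred' block_unblock diff_Suc_1 gr0I less_imp_diff_less unblock_block)
      then show "(if j = block (fst p) + 1 \<and> i = snd p then w $ p else 0)
        = (if p = (unblock (j - 1), i) then (if j = 0 then 0 else w $ p) else 0)"
        by (cases "j = 0"; cases p) auto
    qed
    finally show ?thesis by (simp add: piece_def)
  qed
  then show ?thesis by (simp add: vec_eq_iff)
qed

lemma piece_mpow_W_mat:
  fixes w :: "real^('k::{finite,linorder} \<times> 'm::finite)"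
  assumes "j < CARD('k)"
  shows "piece j (mpow W_mat i *v w) = (if i \<le> j then piece (j - i) w else 0)"
  using assms
proof (induction i arbitrary: j)
  case (Suc i)
  have "piece j (mpow W_mat (Suc i) *v w) = piece j (W_mat *v (mpow W_mat i *v w))"
    by (simp add: matrix_vector_mul_assoc)
  then show ?case using Suc by (auto simp: piece_W_mat)
qed simp

lemma mpow_W_mat_card: "mpow W_mat (CARD('k)) *v w = 0"
  for w :: "real^('k::{finite,linorder} \<times> 'm::finite)"
proof -
  have "(mpow W_mat (CARD('k)) *v w) $ p = 0" for p
  proof -
    have "piece (block (fst p)) (mpow W_mat (CARD('k)) *v w) $ snd p = 0"
      using block_less[of "fst p"] by (simp add: piece_mpow_W_mat)
    then show ?thesis by (simp add: piece_def unblock_block)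
  qed
  then show ?thesis by (simp add: vec_eq_iff)
qed

text \<open>
  Multiplying by \<open>A\<close> raises every power in \<open>\<Sum>j<\<mu>. A\<^sup>j B w\<^sub>j\<close> by one: blocks move down
  by one position, and the last block drops out with coefficient \<open>A\<^sup>\<mu> B\<close>.
\<close>
lemma mat_mult_ctrb:
  fixes A :: "real^'n^'n" and B :: "real^'m^'n" and w :: "real^('k::{finite,linorder} \<times> 'm)"
  shows "A *v (ctrb A B *v w) = ctrb A B *v (W_mat *v w) + mpow A (CARD('k)) *v (B *v (e_mat *v w))"
proof -
  obtain c where c: "CARD('k) = Suc c" using not0_implies_Suc by (metis card_0_eq finite UNIV_not_empty)
  have "A *v (ctrb A B *v w) = (\<Sum>j<Suc c. mpow A (Suc j) *v (B *v piece j w))"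
    by (simp add: ctrb_mult_vec c matrix_vector_mult_sum_right matrix_vector_mul_assoc
        matrix_mul_assoc del: sum.lessThan_Suc)
  also have "\<dots> = (\<Sum>j<c. mpow A (Suc j) *v (B *v piece j w))
      + mpow A (Suc c) *v (B *v (e_mat *v w))"
    by (simp add: e_mat_mult_vec c)
  also have "(\<Sum>j<c. mpow A (Suc j) *v (B *v piece j w)) = ctrb A B *v (W_mat *v w)"
    unfolding ctrb_mult_vec c by (subst sum.lessThan_Suc_shift) (simp add: piece_W_mat c)
  finally show ?thesis by (simp add: c)
qed

text \<open>
  For a constant input both sides are \<open>\<Sum>j\<le>\<mu>. A\<^sup>j B v\<close>, with the first and the last summand
  split off respectively.
\<close>
lemma mat_mult_ctrb_stack:
  fixes A :: "real^'n^'n" and B :: "real^'m^'n" and v :: "real^'m"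
  defines "S \<equiv> ctrb A B :: real^('k::{finite,linorder} \<times> 'm)^'n"
  shows "A *v (S *v stack v) + B *v v = S *v stack v + mpow A (CARD('k)) *v (B *v v)"
proof -
  have "A *v (S *v stack v) + B *v v = (\<Sum>j<Suc (CARD('k)). mpow A j *v (B *v v))"
    unfolding S_def ctrb_mult_vec sum.lessThan_Suc_shift
    by (simp add: piece_stack matrix_vector_mult_sum_right matrix_vector_mul_assoc matrix_mul_assoc)
  then show ?thesis by (simp add: S_def ctrb_mult_vec piece_stack)
qed

text \<open>Iterating the equilibrium equation \<open>\<mu>\<close> times gives the response to a constant input.\<close>
lemma equilibrium_steers_to_itself:
  fixes A :: "real^'n^'n" and B :: "real^'m^'n" and v :: "real^'m"
  assumes "y = A *v y + B *v v"
  shows "y = mpow A (CARD('k)) *v y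
    + (ctrb A B :: real^('k::{finite,linorder} \<times> 'm)^'n) *v stack v"
proof -
  have "y = mpow A k *v y + (\<Sum>j<k. mpow A j *v (B *v v))" for k
  proof (induction k)
    case (Suc k)
    have "mpow A k *v y = mpow A k *v (A *v y) + mpow A k *v (B *v v)"
      using assms by (metis matrix_vector_right_distrib)
    also have "mpow A k *v (A *v y) = mpow A (Suc k) *v y"
      by (simp add: matrix_vector_mul_assoc mpow_commute)
    finally show ?case using Suc by (simp add: algebra_simps)
  qed simp
  from this[of "CARD('k)"] show ?thesis by (simp add: ctrb_mult_vec piece_stack)
qed

text \<open>
  Full row rank makes \<open>transpose S\<close> injective, and \<open>z \<bullet> (S ** transpose S) *v z\<close> is the squared
  norm of \<open>transpose S *v z\<close>; hence \<open>S ** transpose S\<close> is invertible.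
\<close>
lemma full_row_rank_right_inverse:
  fixes S :: "real^'k^'n"
  assumes "rank S = CARD('n)"
  shows "S ** (transpose S ** matrix_inv (S ** transpose S)) = mat 1"
proof -
  have inj: "inj ((*v) (transpose S))"
    using assms by (subst full_rank_injective[symmetric]) (simp add: rank_transpose)
  have "z = 0" if "(S ** transpose S) *v z = 0" for z
  proof -
    have "(transpose S *v z) \<bullet> (transpose S *v z) = z \<bullet> ((S ** transpose S) *v z)"
      by (simp add: matrix_vector_mul_assoc[symmetric] dot_lmul_matrix[symmetric]
          transpose_matrix_vector)
    then have "transpose S *v z = transpose S *v 0" using that by simp
    with inj show ?thesis by (rule injD)
  qed
  then have "invertible (S ** transpose S)"
    by (metis invertible_left_inverse matrix_left_invertible_ker)
  then have "S ** transpose S ** matrix_inv (S ** transpose S) = mat 1"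
    unfolding invertible_def matrix_inv_def by (metis (mono_tags, lifting) someI_ex)
  then show ?thesis by (simp add: matrix_mul_assoc)
qed

section \<open>The closed loop\<close>

theorem mainTheorem3:
  fixes A :: "real^'n^'n" and B :: "real^'m^'n"
    and S :: "real^('k::{finite,linorder} \<times> 'm)^'n"
    and \<mu> :: nat and \<alpha>x lx \<alpha>u lu \<gamma>v \<gamma>x :: real
    and L :: "nat \<Rightarrow> real^'n \<Rightarrow> real^'m \<Rightarrow> real"
    and fx :: "nat \<Rightarrow> real^'n \<Rightarrow> real" and fu :: "nat \<Rightarrow> real^'m \<Rightarrow> real"
    and \<theta> x xhat :: "nat \<Rightarrow> real^'n" and \<eta> u v :: "nat \<Rightarrow> real^'m"
    and g :: "nat \<Rightarrow> real^('k \<times> 'm)"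
    and x0 :: "real^'n" and v0 :: "real^'m" and t' :: nat
  assumes mu: "\<mu> = CARD('k)" and S: "S = ctrb A B"
    and cost: "\<And>t y w. L t y w = fx t y + fu t w"
    and fx: "\<And>t. strongly_convex \<alpha>x (fx t) \<and> smooth lx (fx t)"
    and fu: "\<And>t. strongly_convex \<alpha>u (fu t) \<and> smooth lu (fu t)"
    and theta: "\<And>t. \<theta> t = (ARG_MIN (fx t) y. True)"
    and eta: "\<And>t. \<eta> t = (ARG_MIN (fu t) w. True)"
    and equilibrium: "\<And>t. t \<ge> 1 \<Longrightarrow> \<theta> t = A *v \<theta> t + B *v \<eta> t"
    and controllable: "rank S = CARD('n)"
    and A_bound: "lx = \<alpha>x \<or> spectral_norm A < (lx + \<alpha>x) / (2 * (lx - \<alpha>x))"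
    and alphau: "\<alpha>u > (2 - sqrt 2) / (2 + sqrt 2) * lu"
    and step_pos: "\<gamma>v > 0" "\<gamma>x > 0"
    and step_v: "(2 - sqrt 2) / (2 * \<alpha>u) < \<gamma>v" "\<gamma>v \<le> 2 / (lu + \<alpha>u)"
    and step_x: "A = 0 \<or> (2 * spectral_norm A - 1) / (2 * spectral_norm A * \<alpha>x) < \<gamma>x"
                "\<gamma>x \<le> 2 / (lx + \<alpha>x)"
    and init: "x 0 = x0" "v 0 = v0"
    and plant: "linear_system A B x u"
    and alg: "algorithm1 A S \<gamma>v \<gamma>x fx fu x v xhat g u"
    and fictitious: "\<eta> 0 = v0" "\<theta> 0 = xhat \<mu>"
    and const: "\<And>t. t \<ge> t' \<Longrightarrow> \<theta> t = \<theta> t' \<and> \<eta> t = \<eta> t'"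
  shows "(\<exists>\<Lambda>::real. \<forall>T\<ge>1.
            regret L A B x0 x u T
              \<le> (\<Sum>t=1..T. (fx t (x t) - fx t (\<theta> t) + fu t (u t) - fu t (\<eta> t))) \<and>
            (\<Sum>t=1..T. (fx t (x t) - fx t (\<theta> t) + fu t (u t) - fu t (\<eta> t))) < \<Lambda>) \<and>
         x \<longlonglongrightarrow> \<theta> t' \<and> u \<longlonglongrightarrow> \<eta> t'"
proof -
  define X where "X t = xhat (t + \<mu>)" for t
  define Q where "Q = transpose S ** matrix_inv (S ** transpose S)"
  have mu_pos: "\<mu> \<ge> 1" using mu by (simp add: Suc_leI)
  have SQ: "S *v (Q *v y) = y" for y
    using full_row_rank_right_inverse[OF controllable] by (simp add: Q_def matrix_vector_mul_assoc)
  have v_step: "v (Suc t) = v t - \<gamma>v *\<^sub>R grad (fu t) (v t)"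
    and X_eq: "X t = mpow A \<mu> *v x t + S *v stack (v (Suc t))
       + S *v (\<Sum>i=1..\<mu> - 1. mpow W_mat i *v g (Suc t - i))"
    and g_eq: "g (Suc t) = - (\<gamma>x *\<^sub>R (Q *v grad (fx t) (X t)))"
    and u_eq: "u (Suc t) = v (Suc t) + (\<Sum>i=0..\<mu> - 1. e_mat *v (mpow W_mat i *v g (Suc t - i)))" for t
    using alg[unfolded algorithm1_def Let_def, THEN conjunct2, rule_format, of "Suc t"] mu
    by (simp_all add: X_def Q_def matrix_vector_mul_assoc add.commute)
  have x_step: "x (Suc t) = A *v x t + B *v u (Suc t)" for t
    using plant[unfolded linear_system_def, rule_format, of "Suc t"] by simp

  \<comment> \<open>\<open>G\<close> stacks the corrections decided so far; one application of \<open>W_mat\<close> ages it by one time step,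
      and the block that \<open>e_mat\<close> reads off is the one applied to the plant now.\<close>
  have X_step: "X (Suc t) = A *v (X t + S *v g (Suc t)) + B *v v (Suc t)
      + S *v (stack (v (Suc (Suc t))) - stack (v (Suc t)))" for t
  proof -
    define G where "G = (\<Sum>i=0..\<mu> - 1. mpow W_mat i *v g (Suc t - i))"
    have G_split: "G = g (Suc t) + (\<Sum>i=1..\<mu> - 1. mpow W_mat i *v g (Suc t - i))"
      unfolding G_def by (subst sum.atLeast_Suc_atMost) simp_all
    have eG: "e_mat *v G = u (Suc t) - v (Suc t)"
      by (simp add: G_def u_eq matrix_vector_mult_sum_right)
    have W_pow_zero: "mpow W_mat \<mu> *v g s = 0" for s
      by (simp add: mu mpow_W_mat_card)
    have "W_mat *v G = (\<Sum>i=0..\<mu> - 1. mpow W_mat (Suc i) *v g (Suc (Suc t) - Suc i))"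
      by (simp add: G_def matrix_vector_mult_sum_right matrix_vector_mul_assoc)
    also have "\<dots> = (\<Sum>i=1..\<mu>. mpow W_mat i *v g (Suc (Suc t) - i))"
      using mu_pos by (subst sum.shift_bounds_cl_Suc_ivl[symmetric]) simp
    also have "\<dots> = (\<Sum>i=1..\<mu> - 1. mpow W_mat i *v g (Suc (Suc t) - i))"
      using mu_pos W_pow_zero by (cases \<mu>) (auto simp del: mpow.simps)
    finally have WG: "W_mat *v G = (\<Sum>i=1..\<mu> - 1. mpow W_mat i *v g (Suc (Suc t) - i))" .
    have "X t + S *v g (Suc t) = mpow A \<mu> *v x t + S *v stack (v (Suc t)) + S *v G"
      unfolding X_eq G_split by (simp add: algebra_simps)
    then have "A *v (X t + S *v g (Suc t)) + B *v v (Suc t)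
        = mpow A \<mu> *v (A *v x t) + (A *v (S *v stack (v (Suc t))) + B *v v (Suc t)) + A *v (S *v G)"
      by (simp add: algebra_simps matrix_vector_mul_assoc mpow_commute)
    also have "\<dots> = mpow A \<mu> *v x (Suc t) + S *v stack (v (Suc t)) + S *v (W_mat *v G)"
      unfolding S mat_mult_ctrb_stack mat_mult_ctrb[of A B G] eG x_step mu[symmetric]
      by (simp add: algebra_simps)
    finally show ?thesis
      unfolding X_eq[of "Suc t"] WG by (simp add: algebra_simps)
  qed

  have gx0: "grad (fx t) (\<theta> t) = 0" and gu0: "grad (fu t) (\<eta> t) = 0" for t
    using grad_arg_min_eq_0 fx fu unfolding theta eta by blast+
  define \<rho>v \<rho>x where "\<rho>v = 1 - \<gamma>v * \<alpha>u" and "\<rho>x = 1 - \<gamma>x * \<alpha>x"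
  have v_contr: "norm (v (Suc t) - \<eta> t) \<le> \<rho>v * norm (v t - \<eta> t)" for t
    unfolding v_step \<rho>v_def
    using grad_step_contracts(1)[OF _ _ step_pos(1) step_v(2) gu0] fu by blast
  have \<rho>v: "0 \<le> \<rho>v" "\<rho>v < 1"
    using grad_step_contracts(2,3)[OF _ _ step_pos(1) step_v(2) gu0[of 0]] fu[of 0] by (auto simp: \<rho>v_def)
  define y where "y t = X t - \<gamma>x *\<^sub>R grad (fx t) (X t)" for t
  have y_eq: "y t = X t + S *v g (Suc t)" for t
    by (simp add: y_def g_eq SQ matrix_vector_mult_scaleR matrix_vector_mult_minus_right)
  have y_contr: "norm (y t - \<theta> t) \<le> \<rho>x * norm (X t - \<theta> t)" for t
    unfolding y_def \<rho>x_def
    using grad_step_contracts(1)[OF _ _ step_pos(2) step_x(2) gx0] fx by blast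
  have \<rho>x: "0 \<le> \<rho>x" "\<rho>x < 1" and \<alpha>x: "\<alpha>x > 0"
    using grad_step_contracts(2,3)[OF _ _ step_pos(2) step_x(2) gx0[of 0]] fx[of 0]
    by (auto simp: \<rho>x_def strongly_convex_def)

  have d\<theta>: "norm_summable (\<lambda>t. \<theta> t - \<theta> (Suc t))" and d\<eta>: "norm_summable (\<lambda>t. \<eta> t - \<eta> (Suc t))"
  proof -
    have eq: "\<theta> (Suc t) = \<theta> t" "\<eta> (Suc t) = \<eta> t" if "t \<ge> t'" for t
      using const[OF that] const[OF le_SucI[OF that]] by simp_all
    show "norm_summable (\<lambda>t. \<theta> t - \<theta> (Suc t))"
      by (rule norm_summable_eventually_0[of t']) (simp only: eq diff_self)
    show "norm_summable (\<lambda>t. \<eta> t - \<eta> (Suc t))"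
      by (rule norm_summable_eventually_0[of t']) (simp only: eq diff_self)
  qed

  have v_sum: "norm_summable (\<lambda>t. v t - \<eta> t)"
  proof (rule norm_summable_contraction[OF \<rho>v d\<eta>, of 0])
    fix t
    have "v (Suc t) - \<eta> (Suc t) = (v (Suc t) - \<eta> t) + (\<eta> t - \<eta> (Suc t))" by simp
    then show "norm (v (Suc t) - \<eta> (Suc t)) \<le> \<rho>v * norm (v t - \<eta> t) + norm (\<eta> t - \<eta> (Suc t))"
      using v_contr[of t] norm_triangle_ineq[of "v (Suc t) - \<eta> t" "\<eta> t - \<eta> (Suc t)"] by simp
  qed
  have vS_sum: "norm_summable (\<lambda>t. v (Suc t) - \<eta> t)"
  proof -
    have "norm_summable (\<lambda>t. v (Suc t) - \<eta> (Suc t))"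
      using v_sum by (rule norm_summable_Suc[THEN iffD2])
    from norm_summable_diff[OF this d\<eta>] show ?thesis by simp
  qed
  have dv: "norm_summable (\<lambda>t. v (Suc (Suc t)) - v (Suc t))"
  proof -
    have "norm_summable (\<lambda>t. v (Suc t) - v t)"
      using norm_summable_diff[OF vS_sum v_sum] by simp
    then show ?thesis by (rule norm_summable_Suc[THEN iffD2])
  qed
  have stack_lin: "linear (stack :: real^'m \<Rightarrow> real^('k \<times> 'm))"
    by (rule linearI) (simp_all add: stack_def vec_eq_iff)
  note stack_bl = linear_conv_bounded_linear[THEN iffD1, OF stack_lin]

  define r where "r = spectral_norm A * \<rho>x"
  have A_norm: "norm (A *v z) \<le> spectral_norm A * norm z" for z
    unfolding spectral_norm_def by (rule onorm) simp
  have nA: "spectral_norm A \<ge> 0" unfolding spectral_norm_def by (rule onorm_pos_le) simp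
  have r: "0 \<le> r" "r < 1"
  proof -
    show "0 \<le> r" using nA \<rho>x by (simp add: r_def)
    show "r < 1"
    proof (cases "spectral_norm A = 0")
      case False
      with nA have pos: "spectral_norm A > 0" by simp
      have "A \<noteq> 0"
      proof
        assume "A = 0"
        then have "(*v) A = (\<lambda>_. 0)" by (simp add: fun_eq_iff)
        then show False using pos by (simp add: spectral_norm_def onorm_zero)
      qed
      with step_x(1) pos \<alpha>x have "2 * spectral_norm A - 1 < \<gamma>x * (2 * spectral_norm A * \<alpha>x)"
        by (simp add: pos_divide_less_eq)
      then show ?thesis by (simp add: r_def \<rho>x_def algebra_simps)
    qed (simp add: r_def)
  qed
  \<comment> \<open>\<open>\<theta> 0\<close> need not be an equilibrium, hence the contraction starts at \<open>1\<close>.\<close>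
  have X_sum: "norm_summable (\<lambda>t. X t - \<theta> t)"
  proof -
    define w where "w t = (\<theta> t - \<theta> (Suc t)) + B *v (v (Suc t) - \<eta> t)
        + S *v stack (v (Suc (Suc t)) - v (Suc t))" for t
    have w: "norm_summable w"
      unfolding w_def
      by (intro norm_summable_add d\<theta> norm_summable_mat vS_sum norm_summable_linear[OF _ stack_bl] dv)
    show ?thesis
    proof (rule norm_summable_contraction[OF r w, of 1])
      fix t :: nat assume t: "1 \<le> t"
      have "X (Suc t) - \<theta> (Suc t) = A *v (y t - \<theta> t) + w t"
        using equilibrium[OF t] unfolding X_step y_eq w_def linear_diff[OF stack_lin]
        by (simp add: algebra_simps)
      then have "norm (X (Suc t) - \<theta> (Suc t)) \<le> norm (A *v (y t - \<theta> t)) + norm (w t)"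
        by (simp add: norm_triangle_ineq)
      also have "norm (A *v (y t - \<theta> t)) \<le> spectral_norm A * (\<rho>x * norm (X t - \<theta> t))"
        using A_norm[of "y t - \<theta> t"] mult_left_mono[OF y_contr[of t] nA] by linarith
      finally show "norm (X (Suc t) - \<theta> (Suc t)) \<le> r * norm (X t - \<theta> t) + norm (w t)"
        by (simp add: r_def)
    qed
  qed

  have g_sum: "norm_summable g"
  proof -
    have "norm_summable (\<lambda>t. y t - \<theta> t)"
      using X_sum
    proof (rule norm_summable_bound[of _ 0])
      fix t show "norm (y t - \<theta> t) \<le> norm (X t - \<theta> t)"
        using y_contr[of t] \<rho>x mult_right_mono[of \<rho>x 1 "norm (X t - \<theta> t)"] by simp
    qed
    from norm_summable_diff[OF this X_sum] have "norm_summable (\<lambda>t. Q *v (y t - X t))"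
      by (intro norm_summable_mat) simp
    moreover have "g (Suc t) = Q *v (y t - X t)" for t
      by (simp add: g_eq y_def matrix_vector_mult_scaleR matrix_vector_mult_minus_right)
    ultimately have "norm_summable (\<lambda>t. g (Suc t))" by simp
    then show ?thesis by (rule norm_summable_Suc[THEN iffD1])
  qed
  have g_delay: "norm_summable (\<lambda>t. g (Suc t - i))" for i
    using norm_summable_delay[OF g_sum, of i] by (rule norm_summable_Suc[THEN iffD2])
  have uS_sum: "norm_summable (\<lambda>t. u (Suc t) - \<eta> t)"
  proof -
    have "norm_summable (\<lambda>t. (v (Suc t) - \<eta> t) + (\<Sum>i=0..\<mu> - 1. e_mat *v (mpow W_mat i *v g (Suc t - i))))"
      by (intro norm_summable_add vS_sum norm_summable_sum norm_summable_mat g_delay)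
    then show ?thesis by (simp add: u_eq algebra_simps)
  qed
  have u_sum: "norm_summable (\<lambda>t. u t - \<eta> t)"
  proof -
    have "norm_summable (\<lambda>t. u (Suc t) - \<eta> (Suc t))"
      using norm_summable_add[OF uS_sum d\<eta>] by simp
    then show ?thesis by (rule norm_summable_Suc[THEN iffD1])
  qed

  have A\<mu>_sum: "norm_summable (\<lambda>t. mpow A \<mu> *v (x t - \<theta> t))"
  proof -
    have "norm_summable (\<lambda>t. (X t - \<theta> t) - S *v stack (v (Suc t) - \<eta> t)
        - S *v (\<Sum>i=1..\<mu> - 1. mpow W_mat i *v g (Suc t - i)))"
      by (intro norm_summable_diff X_sum norm_summable_mat norm_summable_linear[OF _ stack_bl] vS_sum
          norm_summable_sum g_delay)
    then show ?thesis
    proof (rule norm_summable_cong[of _ 1])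
      fix t :: nat assume "1 \<le> t"
      then have "\<theta> t = mpow A \<mu> *v \<theta> t + S *v stack (\<eta> t)"
        unfolding S mu by (intro equilibrium_steers_to_itself equilibrium)
      then show "mpow A \<mu> *v (x t - \<theta> t) = (X t - \<theta> t) - S *v stack (v (Suc t) - \<eta> t)
        - S *v (\<Sum>i=1..\<mu> - 1. mpow W_mat i *v g (Suc t - i))"
        unfolding X_eq linear_diff[OF stack_lin] by (simp add: algebra_simps)
    qed
  qed
  \<comment> \<open>The plant equation writes the error at power \<open>k\<close> and time \<open>Suc t\<close> through the error at
      power \<open>Suc k\<close> and time \<open>t\<close>, so the power descends although \<open>A\<close> need not be stable.\<close>
  have "norm_summable (\<lambda>t. mpow A 0 *v (x t - \<theta> t))"
  proof (rule inc_induct[of 0 \<mu> "\<lambda>k. norm_summable (\<lambda>t. mpow A k *v (x t - \<theta> t))"])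
    fix k assume IH: "norm_summable (\<lambda>t. mpow A (Suc k) *v (x t - \<theta> t))"
    have "norm_summable (\<lambda>t. mpow A (Suc k) *v (x t - \<theta> t)
        + mpow A k *v (B *v (u (Suc t) - \<eta> t) + (\<theta> t - \<theta> (Suc t))))"
      by (intro norm_summable_add IH norm_summable_mat uS_sum d\<theta>)
    then have "norm_summable (\<lambda>t. mpow A k *v (x (Suc t) - \<theta> (Suc t)))"
    proof (rule norm_summable_cong[of _ 1])
      fix t :: nat assume t: "1 \<le> t"
      have step: "x (Suc t) - \<theta> (Suc t)
          = A *v (x t - \<theta> t) + (B *v (u (Suc t) - \<eta> t) + (\<theta> t - \<theta> (Suc t)))"
        using equilibrium[OF t] by (simp add: x_step algebra_simps)
      show "mpow A k *v (x (Suc t) - \<theta> (Suc t)) = mpow A (Suc k) *v (x t - \<theta> t)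
          + mpow A k *v (B *v (u (Suc t) - \<eta> t) + (\<theta> t - \<theta> (Suc t)))"
        unfolding step matrix_vector_right_distrib[of _ "A *v _"]
        by (simp add: matrix_vector_mul_assoc mpow_commute)
    qed
    then show "norm_summable (\<lambda>t. mpow A k *v (x t - \<theta> t))"
      by (rule norm_summable_Suc[THEN iffD1])
  qed (use A\<mu>_sum in auto)
  then have x_sum: "norm_summable (\<lambda>t. x t - \<theta> t)" by simp

  have x_lim: "x \<longlonglongrightarrow> \<theta> t'" and u_lim: "u \<longlonglongrightarrow> \<eta> t'"
  proof -
    have "eventually (\<lambda>t. \<theta> t = \<theta> t') sequentially" "eventually (\<lambda>t. \<eta> t = \<eta> t') sequentially"
      by (rule eventually_sequentiallyI[of t'], use const in blast)+
    then have "\<theta> \<longlonglongrightarrow> \<theta> t'" "\<eta> \<longlonglongrightarrow> \<eta> t'"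
      by (simp_all only: tendsto_eventually)
    from tendsto_add[OF norm_summable_tendsto_0[OF x_sum] this(1)]
      tendsto_add[OF norm_summable_tendsto_0[OF u_sum] this(2)]
    show "x \<longlonglongrightarrow> \<theta> t'" "u \<longlonglongrightarrow> \<eta> t'" by simp_all
  qed

  define c where "c t = fx t (x t) - fx t (\<theta> t) + fu t (u t) - fu t (\<eta> t)" for t
  have min_x: "fx t (\<theta> t) \<le> fx t z" and min_u: "fu t (\<eta> t) \<le> fu t z'" for t z z'
    using strongly_convex_attains_min fx fu unfolding theta eta by blast+
  have c0: "c t \<ge> 0" for t
    using min_x[of t "x t"] min_u[of t "u t"] by (simp add: c_def)
  have c_le: "c t \<le> lx / 2 * (norm (x t - \<theta> t))\<^sup>2 + lu / 2 * (norm (u t - \<eta> t))\<^sup>2" for t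
    using cost_gap_le[of \<alpha>x "fx t" lx "x t"] cost_gap_le[of \<alpha>u "fu t" lu "u t"] fx[of t] fu[of t]
    unfolding c_def theta[symmetric] eta[symmetric] by linarith
  have "summable (\<lambda>t. lx / 2 * (norm (x t - \<theta> t))\<^sup>2 + lu / 2 * (norm (u t - \<eta> t))\<^sup>2)"
    by (intro summable_add summable_mult norm_summable_square x_sum u_sum)
  then have c_sum: "summable c"
    by (rule summable_comparison_test'[of _ 0]) (use c0 c_le in auto)
  \<comment> \<open>The summand \<open>1\<close> makes the bound strict.\<close>
  have bound: "(\<Sum>t=1..T. c t) < suminf c + 1" for T
    using sum_le_suminf[OF c_sum, of "{1..T}"] c0 by simp
  \<comment> \<open>The stagewise comparison holds for any pair \<open>(xs, us)\<close>, hence whichever one \<open>arg_min\<close> selects.\<close>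
  have regret_le: "regret L A B x0 x u T \<le> (\<Sum>t=1..T. c t)" for T
  proof -
    obtain xs us where opt: "arg_min (total_cost L T) (feasible A B x0 T) = (xs, us)"
      by (metis surj_pair)
    have "L t (x t) (u t) - L t (xs t) (us t) \<le> c t" for t
      using min_x[of t "xs t"] min_u[of t "us t"] by (simp add: cost c_def)
    then show ?thesis by (simp add: regret_def opt sum_mono)
  qed
  show ?thesis
    using bound regret_le x_lim u_lim unfolding c_def by blast
qed

end
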